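(* For every non-empty compact subset $K$ of $\mathbb{R}^n$, the zonoid map $$\Phi\colon\mathcal{P}^n(K)\to\mathcal{Z}^n,\qquad \Phi(\mu)=Z(\mu),$$ is continuous, where $\mathcal{P}^n(K)$ carries the topology of weak convergence and $\mathcal{Z}^n$ carries the topology induced by the Hausdorff metric $d_H$.
   Context: $\mathcal{M}^n$ is the set of all non-negative, finite Borel measures $\mu$ on $\mathbb{R}^n$ with finite first moment (i.e. $\int_{\mathbb{R}^n}\|x\|\,d\mu(x)<\infty$). For $\mu\in\mathcal{M}^n$ the zonoid associated to $\mu$ is $$Z(\mu)=\left\{\int_{\mathbb{R}^n}\phi(x)\,x\,d\mu(x)\ :\ \phi\colon\mathbb{R}^n\to[0,1]\text{ measurable}\right\}\subseteq\mathbb{R}^n,$$ which is a compact convex set; integrals of vectors are taken componentwise. $\mathcal{Z}^n=\{Z(\mu):\mu\in\mathcal{M}^n\}$ is the set of zonoids of $\mathbb{R}^n$, a subset of the set of convex bodies (non-empty compact convex sets) of $\mathbb{R}^n$. For convex bodies $K,L$, $$d_H(K,L)=\min\{\epsilon\ge 0 : K\subseteq L+\epsilon B^n,\ L\subseteq K+\epsilon B^n\},$$ with $B^n$ the Euclidean unit ball. For a non-empty closed $K\subseteq\mathbb{R}^n$, $\mathcal{P}^n(K)$ is the set of Borel probability measures on $\mathbb{R}^n$ with support contained in $K$, with the (metrizable) topology of weak convergence: $\mu_k\Rightarrow\mu$ iff $\int_K f\,d\mu_k\to\int_K f\,d\mu$ for every bounded continuous $f\colon K\to\mathbb{R}$.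 If $K$ is compact, $\mathcal{P}^n(K)\subseteq\mathcal{M}^n$. *)

theory Defs
  imports "HOL-Probability.Probability"
begin

section \<open>Measures and zonoids\<close>

definition moment_measures :: "(real ^ 'n) measure set" where
  "moment_measures =
     {\<mu>. sets \<mu> = sets borel \<and> finite_measure \<mu> \<and> (\<integral>\<^sup>+x. ennreal (norm x) \<partial>\<mu>) < \<infinity>}"

definition zonoid :: "(real ^ 'n) measure \<Rightarrow> (real ^ 'n) set" where
  "zonoid \<mu> =
     {(\<integral>x. \<phi> x *\<^sub>R x \<partial>\<mu>) | \<phi>. \<phi> \<in> borel_measurable borel \<and> (\<forall>x. \<phi> x \<in> {0..1::real})}"

definition zonoids :: "(real ^ 'n) set set" where
  "zonoids = zonoid ` moment_measures"

section \<open>The Hausdorff metric\<close>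

definition convex_bodies :: "(real ^ 'n) set set" where
  "convex_bodies = {K. compact K \<and> convex K \<and> K \<noteq> {}}"

definition parallel_body :: "(real ^ 'n) set \<Rightarrow> real \<Rightarrow> (real ^ 'n) set" where
  "parallel_body L e = {y + e *\<^sub>R b | y b. y \<in> L \<and> b \<in> cball 0 1}"

definition hausdorff_radii :: "(real ^ 'n) set \<Rightarrow> (real ^ 'n) set \<Rightarrow> real set" where
  "hausdorff_radii K L = {e. 0 \<le> e \<and> K \<subseteq> parallel_body L e \<and> L \<subseteq> parallel_body K e}"

text \<open>
  On convex bodies the infimum is a minimum (lemma \<open>hausdorff_dist_is_min\<close>). Elsewhere the value is
  set to 0, because the locale \<^locale>\<open>Metric_space\<close> requires a non-negative function on
  the whole type.
\<close>

definition hausdorff_dist :: "(real ^ 'n) set \<Rightarrow> (real ^ 'n) set \<Rightarrow> real" where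
  "hausdorff_dist K L =
     (if K \<in> convex_bodies \<and> L \<in> convex_bodies then Inf (hausdorff_radii K L) else 0)"

lemma mem_parallel_body_iff:
  assumes "compact L" "L \<noteq> {}" "0 \<le> e"
  shows "x \<in> parallel_body L e \<longleftrightarrow> infdist x L \<le> e"
proof
  assume "x \<in> parallel_body L e"
  then obtain y b where yb: "x = y + e *\<^sub>R b" "y \<in> L" "norm b \<le> 1"
    by (auto simp: parallel_body_def)
  have "infdist x L \<le> dist x y"
    by (rule infdist_le[OF yb(2)])
  also have "\<dots> = e * norm b"
    using yb assms(3) by (simp add: dist_norm)
  also have "\<dots> \<le> e"
    using yb(3) assms(3) by (simp add: mult_left_le)
  finally show "infdist x L \<le> e" .
next
  assume le: "infdist x L \<le> e"
  obtain y where y: "y \<in> L" "infdist x L = dist x y"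
    using infdist_attains_inf[OF compact_imp_closed[OF assms(1)] assms(2)] by blast
  show "x \<in> parallel_body L e"
  proof (cases "e = 0")
    case True
    then have "x = y + e *\<^sub>R 0" using le y by simp
    then show ?thesis using y unfolding parallel_body_def by force
  next
    case False
    define b where "b = (1 / e) *\<^sub>R (x - y)"
    have "norm b \<le> 1"
      using False assms(3) le y by (simp add: b_def dist_norm divide_simps)
    moreover have "x = y + e *\<^sub>R b"
      using False by (simp add: b_def)
    ultimately show ?thesis using y unfolding parallel_body_def by auto
  qed
qed

lemma hausdorff_radii_eq:
  assumes "K \<in> convex_bodies" "L \<in> convex_bodies"
  shows "hausdorff_radii K L =
    {e. 0 \<le> e \<and> (\<forall>x\<in>K. infdist x L \<le> e) \<and> (\<forall>y\<in>L. infdist y K \<le> e)}"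
proof -
  have KL: "compact K" "K \<noteq> {}" "compact L" "L \<noteq> {}"
    using assms by (auto simp: convex_bodies_def)
  show ?thesis
    unfolding hausdorff_radii_def
    using mem_parallel_body_iff[OF KL(1,2)] mem_parallel_body_iff[OF KL(3,4)]
    by (auto simp: subset_iff)
qed

theorem hausdorff_dist_is_min:
  assumes "K \<in> convex_bodies" "L \<in> convex_bodies"
  shows "hausdorff_dist K L \<in> hausdorff_radii K L"
    and "\<And>e. e \<in> hausdorff_radii K L \<Longrightarrow> hausdorff_dist K L \<le> e"
proof -
  have eq: "hausdorff_radii K L =
      {0..} \<inter> (\<Inter>x\<in>K. {infdist x L..}) \<inter> (\<Inter>y\<in>L. {infdist y K..})"
    by (auto simp: hausdorff_radii_eq[OF assms])
  have cl: "closed (hausdorff_radii K L)"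
    unfolding eq by (intro closed_Int closed_INT ballI closed_atLeast)
  have KL: "compact K" "compact L"
    using assms by (auto simp: convex_bodies_def)
  have bdd: "bounded ((\<lambda>x. infdist x L) ` K)" "bounded ((\<lambda>y. infdist y K) ` L)"
    using KL by (auto intro!: compact_imp_bounded compact_continuous_image
        continuous_on_infdist continuous_on_id)
  obtain a where a: "\<And>x. x \<in> K \<Longrightarrow> infdist x L \<le> a"
    using bdd(1) by (auto simp: bounded_iff dest: abs_le_D1)
  obtain b where b: "\<And>y. y \<in> L \<Longrightarrow> infdist y K \<le> b"
    using bdd(2) by (auto simp: bounded_iff dest: abs_le_D1)
  have "max 0 (max a b) \<in> hausdorff_radii K L"
    using a b by (force simp: hausdorff_radii_eq[OF assms] le_max_iff_disj)
  then have ne: "hausdorff_radii K L \<noteq> {}" by blast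
  have bb: "bdd_below (hausdorff_radii K L)"
    by (rule bdd_belowI[of _ 0]) (simp add: hausdorff_radii_def)
  show "hausdorff_dist K L \<in> hausdorff_radii K L"
    using closed_contains_Inf[OF ne bb cl] assms by (simp add: hausdorff_dist_def)
  show "\<And>e. e \<in> hausdorff_radii K L \<Longrightarrow> hausdorff_dist K L \<le> e"
    using cInf_lower[OF _ bb] assms by (simp add: hausdorff_dist_def)
qed

lemma parallel_body_trans:
  assumes "K \<subseteq> parallel_body L e" "L \<subseteq> parallel_body M f"
    and "compact L" "L \<noteq> {}" "compact M" "M \<noteq> {}" "0 \<le> e" "0 \<le> f"
  shows "K \<subseteq> parallel_body M (e + f)"
proof
  fix x assume "x \<in> K"
  then have x: "infdist x L \<le> e"
    using assms mem_parallel_body_iff by blast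
  obtain y where y: "y \<in> L" "infdist x L = dist x y"
    using infdist_attains_inf[OF compact_imp_closed[OF assms(3)] assms(4)] by blast
  have "infdist y M \<le> f"
    using y(1) assms mem_parallel_body_iff by blast
  then have "infdist x M \<le> e + f"
    using infdist_triangle[of x M y] x y by (simp add: dist_commute)
  then show "x \<in> parallel_body M (e + f)"
    using assms by (simp add: mem_parallel_body_iff)
qed

theorem Metric_space_convex_bodies:
  "Metric_space (convex_bodies :: (real ^ 'n) set set) hausdorff_dist"
proof
  fix K L M :: "(real ^ 'n) set"
  show "0 \<le> hausdorff_dist K L"
    using hausdorff_dist_is_min(1)[of K L]
    by (cases "K \<in> convex_bodies \<and> L \<in> convex_bodies")
      (auto simp: hausdorff_radii_def, auto simp: hausdorff_dist_def)
  have "hausdorff_radii K L = hausdorff_radii L K"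
    by (auto simp: hausdorff_radii_def)
  then show "hausdorff_dist K L = hausdorff_dist L K"
    by (simp add: hausdorff_dist_def conj_commute)
  show "hausdorff_dist K L = 0 \<longleftrightarrow> K = L"
    if KL: "K \<in> convex_bodies" "L \<in> convex_bodies"
  proof -
    have z: "parallel_body M 0 = M" for M :: "(real ^ 'n) set"
      unfolding parallel_body_def by (auto intro: exI[of _ 0])
    have "hausdorff_dist K L = 0 \<longleftrightarrow> 0 \<in> hausdorff_radii K L"
      using hausdorff_dist_is_min[OF KL]
      by (metis (mono_tags, lifting) antisym hausdorff_radii_def mem_Collect_eq)
    then show ?thesis
      by (auto simp: hausdorff_radii_def z)
  qed
  show "hausdorff_dist K M \<le> hausdorff_dist K L + hausdorff_dist L M"
    if KLM: "K \<in> convex_bodies" "L \<in> convex_bodies" "M \<in> convex_bodies"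
  proof (rule hausdorff_dist_is_min(2)[OF KLM(1,3)])
    have c: "compact K" "K \<noteq> {}" "compact L" "L \<noteq> {}" "compact M" "M \<noteq> {}"
      using KLM by (auto simp: convex_bodies_def)
    define e f where ef: "e = hausdorff_dist K L" "f = hausdorff_dist L M"
    have 1: "0 \<le> e" "K \<subseteq> parallel_body L e" "L \<subseteq> parallel_body K e"
      and 2: "0 \<le> f" "L \<subseteq> parallel_body M f" "M \<subseteq> parallel_body L f"
      using hausdorff_dist_is_min(1)[OF KLM(1,2)] hausdorff_dist_is_min(1)[OF KLM(2,3)]
      unfolding ef hausdorff_radii_def by auto
    have "M \<subseteq> parallel_body K (f + e)"
      by (rule parallel_body_trans[OF 2(3) 1(3) c(3,4,1,2) 2(1) 1(1)])
    moreover have "K \<subseteq> parallel_body M (e + f)"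
      by (rule parallel_body_trans[OF 1(2) 2(2) c(3-6) 1(1) 2(1)])
    ultimately show "hausdorff_dist K L + hausdorff_dist L M \<in> hausdorff_radii K M"
      using 1 2 by (simp add: hausdorff_radii_def add.commute flip: ef)
  qed
qed

definition zonoid_topology :: "(real ^ 'n) set topology" where
  "zonoid_topology = subtopology (Metric_space.mtopology convex_bodies hausdorff_dist) zonoids"

section \<open>Probability measures with the weak topology\<close>

definition measure_support :: "'a :: topological_space measure \<Rightarrow> 'a set" where
  "measure_support \<mu> = {x. \<forall>U. open U \<longrightarrow> x \<in> U \<longrightarrow> 0 < emeasure \<mu> U}"

definition prob_measures_on :: "(real ^ 'n) set \<Rightarrow> (real ^ 'n) measure set" where
  "prob_measures_on K =
     {\<mu>. sets \<mu> = sets borel \<and> prob_space \<mu> \<and> measure_support \<mu> \<subseteq> K}"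

text \<open>
  The coarsest topology for which all the maps \<open>\<mu> \<mapsto> \<integral>\<^sub>K f d\<mu>\<close> with bounded continuous
  \<open>f : K \<rightarrow> \<real>\<close> are continuous. Such an \<open>f\<close> is represented by a function on the whole space, of
  which only the restriction to \<open>K\<close> matters.
\<close>

definition weak_topology_on :: "(real ^ 'n) set \<Rightarrow> (real ^ 'n) measure topology" where
  "weak_topology_on K =
     topology_generated_by
       {{\<mu> \<in> prob_measures_on K. (LINT x:K|\<mu>. f x) \<in> U} | f U.
          continuous_on K f \<and> bounded (f ` K) \<and> open (U :: real set)}"

lemma topspace_weak_topology_on [simp]: "topspace (weak_topology_on K) = prob_measures_on K"
proof -
  have "prob_measures_on K = {\<mu> \<in> prob_measures_on K. (LINT x:K|\<mu>. (0::real)) \<in> UNIV}"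
    by simp
  moreover have "continuous_on K (\<lambda>_. 0 :: real)" "bounded ((\<lambda>_. 0 :: real) ` K)"
    by (auto intro: boundedI)
  ultimately have "prob_measures_on K \<in>
      {{\<mu> \<in> prob_measures_on K. (LINT x:K|\<mu>. f x) \<in> U} | f U.
          continuous_on K f \<and> bounded (f ` K) \<and> open (U :: real set)}"
    using open_UNIV by blast
  then show ?thesis
    unfolding weak_topology_on_def topology_generated_by_topspace by blast
qed

theorem limitin_weak_topology_on:
  "limitin (weak_topology_on K) \<mu>s \<mu> sequentially \<longleftrightarrow>
     \<mu> \<in> prob_measures_on K \<and> (\<forall>\<^sub>F k in sequentially. \<mu>s k \<in> prob_measures_on K) \<and>
     (\<forall>f :: real ^ 'n \<Rightarrow> real. continuous_on K f \<longrightarrow> bounded (f ` K) \<longrightarrow>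
        (\<lambda>k. LINT x:K|\<mu>s k. f x) \<longlonglongrightarrow> (LINT x:K|\<mu>. f x))"
  (is "?L \<longleftrightarrow> ?R")
proof
  assume L: ?L
  have \<mu>: "\<mu> \<in> prob_measures_on K"
    using L by (simp add: limitin_def)
  have ev: "\<forall>\<^sub>F k in sequentially. \<mu>s k \<in> prob_measures_on K"
    using L \<mu> openin_topspace[of "weak_topology_on K"] by (simp add: limitin_def)
  have "(\<lambda>k. LINT x:K|\<mu>s k. f x) \<longlonglongrightarrow> (LINT x:K|\<mu>. f x)"
    if f: "continuous_on K f" "bounded (f ` K)" for f :: "real ^ 'n \<Rightarrow> real"
  proof (rule topological_tendstoI)
    fix U :: "real set" assume U: "open U" "(LINT x:K|\<mu>. f x) \<in> U"
    let ?B = "{\<nu> \<in> prob_measures_on K. (LINT x:K|\<nu>. f x) \<in> U}"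
    have "openin (weak_topology_on K) ?B"
      unfolding weak_topology_on_def
      by (rule topology_generated_by_Basis) (use f U in blast)
    moreover have "\<mu> \<in> ?B" using \<mu> U by simp
    ultimately have "\<forall>\<^sub>F k in sequentially. \<mu>s k \<in> ?B"
      using L unfolding limitin_def by blast
    then show "\<forall>\<^sub>F k in sequentially. (LINT x:K|\<mu>s k. f x) \<in> U"
      by (rule eventually_mono) simp
  qed
  then show ?R using \<mu> ev by blast
next
  assume R: ?R
  have "\<mu> \<in> V \<longrightarrow> (\<forall>\<^sub>F k in sequentially. \<mu>s k \<in> V)" if "openin (weak_topology_on K) V" for V
  proof -
    have "generate_topology_on
       {{\<mu> \<in> prob_measures_on K. (LINT x:K|\<mu>. f x) \<in> U} | f U.
          continuous_on K f \<and> bounded (f ` K) \<and> open (U :: real set)} V"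
      using that unfolding weak_topology_on_def by (rule openin_topology_generated_by)
    then show ?thesis
    proof induction
      case Empty
      show ?case by simp
    next
      case (Int a b)
      then show ?case by (auto simp: eventually_conj_iff)
    next
      case (UN C)
      show ?case
      proof
        assume "\<mu> \<in> \<Union> C"
        then obtain c where c: "c \<in> C" "\<mu> \<in> c" by blast
        then have "\<forall>\<^sub>F k in sequentially. \<mu>s k \<in> c" using UN.IH by blast
        then show "\<forall>\<^sub>F k in sequentially. \<mu>s k \<in> \<Union> C"
          by (rule eventually_mono) (use c in blast)
      qed
    next
      case (Basis s)
      then obtain f U where s: "s = {\<mu> \<in> prob_measures_on K. (LINT x:K|\<mu>. f x) \<in> U}"
        "continuous_on K f" "bounded (f ` K)" "open (U :: real set)"
        by blast
      have "\<forall>\<^sub>F k in sequentially. (LINT x:K|\<mu>s k. f x) \<in> U" if "\<mu> \<in> s"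
        using R s(2-4) that unfolding s(1) by (auto dest!: spec[of _ f] intro: topological_tendstoD)
      then show ?case
        using R unfolding s(1) by (auto simp: eventually_conj_iff)
    qed
  qed
  then show ?L using R by (simp add: limitin_def)
qed

end

theory Submission
  imports Defs
begin

text \<open>
  The support function of \<open>Z(\<mu>)\<close> is \<open>h\<^sub>\<mu>(u) = \<integral> max 0 \<langle>u, x\<rangle> d\<mu>(x)\<close>: the largest value of
  \<open>\<langle>u, \<integral> \<phi>(x) x d\<mu>(x)\<rangle> = \<integral> \<phi>(x) \<langle>u, x\<rangle> d\<mu>(x)\<close> is reached by the indicator function \<open>\<phi>\<close> of the half-space
  \<open>\<langle>u, x\<rangle> > 0\<close>. For every fixed \<open>u\<close> it is the integral of a function that is continuous, and bounded on
  \<open>K\<close>, hence it is weakly continuous in \<open>\<mu>\<close>. If \<open>K\<close> lies in the ball of radius \<open>B\<close>, then all the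
  \<open>h\<^sub>\<mu>\<close> with \<open>\<mu>\<close> a probability measure on \<open>K\<close> are \<open>B\<close>-Lipschitz in \<open>u\<close>, so that closeness of
  \<open>h\<^sub>\<mu>\<close> and \<open>h\<^sub>\<nu>\<close> on a finite net of the unit sphere gives uniform closeness on the sphere. The net
  determines a weak neighbourhood of \<open>\<mu>\<close>.

  Uniform closeness of support functions bounds the Hausdorff distance of compact convex sets
  (\<open>zonoid_subset_parallel_body\<close>): if \<open>y\<close> is the point of \<open>Z(\<nu>)\<close> closest to \<open>z \<in> Z(\<mu>)\<close>, then in the
  direction \<open>u\<close> of \<open>z - y\<close> the distance is at most \<open>h\<^sub>\<mu>(u) - h\<^sub>\<nu>(u)\<close>.

  It remains to see that zonoids are compact, where closedness is the point. Usually it comes from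
  the weak-* compactness of the set of densities \<open>\<phi>\<close>. Here an elementary Hilbert space argument
  replaces it (\<open>AE_convergent_selection\<close>): the densities whose integral is within \<open>1/k\<close> of a given
  limit point form decreasing convex sets, almost minimal elements of these sets for the \<open>L\<^sup>2\<close> norm form
  a Cauchy sequence by the parallelogram law, and a rapidly converging choice converges almost
  everywhere. Dominated convergence does the rest.
\<close>

section \<open>Almost everywhere convergent selections of densities\<close>

definition densities :: "'a measure \<Rightarrow> ('a \<Rightarrow> real) set" where
  "densities M = {\<phi> \<in> borel_measurable M. \<forall>x. \<phi> x \<in> {0..1}}"

lemma (in finite_measure) integrable_density_square:
  assumes "f \<in> densities M"
  shows "integrable M (\<lambda>x. (f x)\<^sup>2)"
  using assms
  by (intro integrable_const_bound[of _ 1])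
     (auto simp: densities_def abs_square_le_1)

lemma (in finite_measure) integrable_density_diff:
  assumes "f \<in> densities M" "g \<in> densities M"
  shows "integrable M (\<lambda>x. f x - g x)"
proof -
  have "integrable M f" if "f \<in> densities M" for f
    using that by (intro integrable_const_bound[of _ 1]) (auto simp: densities_def)
  then show ?thesis using assms by auto
qed

lemma (in finite_measure) parallelogram_densities:
  assumes f: "f \<in> densities M" and g: "g \<in> densities M"
  shows "(\<integral>x. (f x - g x)\<^sup>2 \<partial>M) =
    2 * (\<integral>x. (f x)\<^sup>2 \<partial>M) + 2 * (\<integral>x. (g x)\<^sup>2 \<partial>M) - 4 * (\<integral>x. ((f x + g x) / 2)\<^sup>2 \<partial>M)"
proof -
  have h: "(\<lambda>x. (f x + g x) / 2) \<in> densities M"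
    using f g by (auto simp: densities_def intro: add_nonneg_nonneg) (smt (verit))
  have "(\<integral>x. (f x - g x)\<^sup>2 \<partial>M) =
      (\<integral>x. 2 * (f x)\<^sup>2 + 2 * (g x)\<^sup>2 - 4 * ((f x + g x) / 2)\<^sup>2 \<partial>M)"
    by (intro Bochner_Integration.integral_cong) (auto simp: power2_eq_square field_simps)
  then show ?thesis
    using integrable_density_square[OF f] integrable_density_square[OF g]
      integrable_density_square[OF h]
    by simp
qed

text \<open>
  By \<open>2 \<bar>a\<bar> \<le> 2\<^sup>k a\<^sup>2 + 2\<^sup>-\<^sup>k\<close>, which stands in for the Cauchy-Schwarz inequality, the sum of the
  \<open>L\<^sup>1\<close> norms of the increments is finite.
\<close>

lemma (in finite_measure) AE_convergent_if_fast_L2_Cauchy: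
  assumes f: "\<And>k. f k \<in> densities M"
    and fast: "\<And>k. (\<integral>x. (f (Suc k) x - f k x)\<^sup>2 \<partial>M) \<le> C * (1/4)^k"
  shows "AE x in M. convergent (\<lambda>k. f k x)"
proof -
  define m where "m = measure M (space M)"
  define d where "d k x = f (Suc k) x - f k x" for k x
  have meas [measurable]: "\<And>k. f k \<in> borel_measurable M"
    using f by (auto simp: densities_def)
  then have [measurable]: "\<And>k. d k \<in> borel_measurable M"
    unfolding d_def by measurable
  have int: "integrable M (\<lambda>x. \<bar>d k x\<bar>)" for k
    using integrable_density_diff[OF f f] unfolding d_def by auto
  have int2: "integrable M (\<lambda>x. (d k x)\<^sup>2)" for k
  proof (rule integrable_const_bound[of _ 1])
    have "\<bar>d k x\<bar> \<le> 1" for x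
      using f[of k] f[of "Suc k"] unfolding densities_def d_def by (auto simp: abs_le_iff) (smt (verit))+
    then show "AE x in M. norm ((d k x)\<^sup>2) \<le> 1"
      by (simp add: abs_square_le_1)
  qed measurable
  have L1: "(\<integral>x. \<bar>d k x\<bar> \<partial>M) \<le> (C + m) / 2 * (1/2)^k" for k
  proof -
    have "\<bar>d k x\<bar> \<le> 2^k * (d k x)\<^sup>2 / 2 + (1/2)^k / 2" for x
    proof -
      have "0 \<le> (1/2)^k * (2^k * \<bar>d k x\<bar> - 1)\<^sup>2"
        by simp
      also have "\<dots> = 2^k * (d k x)\<^sup>2 - 2 * \<bar>d k x\<bar> + (1/2)^k"
        by (simp add: power2_diff power_mult_distrib field_simps power2_eq_square)
      finally show ?thesis by simp
    qed
    then have "(\<integral>x. \<bar>d k x\<bar> \<partial>M) \<le> (\<integral>x. 2^k * (d k x)\<^sup>2 / 2 + (1/2)^k / 2 \<partial>M)"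
      using int int2 by (intro integral_mono) auto
    also have "\<dots> = 2^k * (\<integral>x. (d k x)\<^sup>2 \<partial>M) / 2 + (1/2)^k / 2 * m"
      using int2 by (simp add: m_def)
    also have "\<dots> \<le> 2^k * (C * (1/4)^k) / 2 + (1/2)^k / 2 * m"
      using fast[of k] by (simp add: d_def)
    also have "\<dots> = (C + m) / 2 * (1/2)^k"
    proof -
      have "(2::real)^k * (1/4)^k = (1/2)^k"
        by (simp flip: power_mult_distrib)
      then show ?thesis by (simp add: algebra_simps)
    qed
    finally show ?thesis .
  qed
  have "summable (\<lambda>k. \<integral>x. \<bar>d k x\<bar> \<partial>M)"
    by (rule summable_comparison_test'[of "\<lambda>k. (C + m) / 2 * (1/2)^k"])
       (use L1 in \<open>auto intro: summable_mult\<close>)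
  then have "(\<Sum>k. ennreal (\<integral>x. \<bar>d k x\<bar> \<partial>M)) \<noteq> \<infinity>"
    by (subst suminf_ennreal2) auto
  moreover have "(\<integral>\<^sup>+x. (\<Sum>k. ennreal \<bar>d k x\<bar>) \<partial>M) = (\<Sum>k. ennreal (\<integral>x. \<bar>d k x\<bar> \<partial>M))"
    using int by (subst nn_integral_suminf) (auto simp: nn_integral_eq_integral)
  ultimately have "AE x in M. (\<Sum>k. ennreal \<bar>d k x\<bar>) \<noteq> \<infinity>"
    by (intro nn_integral_PInf_AE) auto
  then show ?thesis
  proof (rule AE_mp, intro AE_I2 impI)
    fix x assume "(\<Sum>k. ennreal \<bar>d k x\<bar>) \<noteq> \<infinity>"
    then have "summable (\<lambda>k. \<bar>d k x\<bar>)"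
      by (intro summable_suminf_not_top) auto
    then have "summable (\<lambda>k. d k x)"
      by (rule summable_rabs_cancel)
    then have "convergent (\<lambda>n. (\<Sum>k<n. d k x) + f 0 x)"
      by (intro convergent_add convergent_const) (simp add: summable_iff_convergent)
    moreover have "(\<Sum>k<n. d k x) + f 0 x = f n x" for n
      unfolding d_def using sum_lessThan_telescope[of "\<lambda>k. f k x" n] by simp
    ultimately show "convergent (\<lambda>k. f k x)"
      by simp
  qed
qed

text \<open>
  The infima of the squared \<open>L\<^sup>2\<close> norm over the sets \<open>D k\<close> increase to some limit \<open>s\<close>. If \<open>f\<close> and \<open>g\<close>
  have squared norm at most \<open>s + \<epsilon>\<close> and their midpoint, which lies in the larger of the two sets they
  come from, has squared norm at least \<open>s - \<epsilon>\<close>, then the parallelogram law gives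
  \<open>\<parallel>f - g\<parallel>\<^sup>2 \<le> 8 \<epsilon>\<close>.
\<close>

lemma (in finite_measure) AE_convergent_selection:
  assumes D: "\<And>k. D k \<subseteq> densities M" "\<And>k. D k \<noteq> {}" "decseq D"
    and mid: "\<And>k f g. f \<in> D k \<Longrightarrow> g \<in> D k \<Longrightarrow> (\<lambda>x. (f x + g x) / 2) \<in> D k"
  obtains f where "\<And>k. f k \<in> D k" "AE x in M. convergent (\<lambda>k. f k x)"
proof -
  define q where "q f = (\<integral>x. (f x)\<^sup>2 \<partial>M)" for f :: "'a \<Rightarrow> real"
  define d where "d k = Inf (q ` D k)" for k
  define s where "s = Sup (range d)"
  have bdd: "bdd_below (q ` D k)" for k
    by (rule bdd_belowI[of _ 0]) (auto simp: q_def)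
  have q_ge: "d k \<le> q f" if "f \<in> D k" for f k
    unfolding d_def using bdd that by (intro cInf_lower) auto
  have inc: "d j \<le> d k" if "j \<le> k" for j k
    unfolding d_def using bdd D(2,3) that by (intro cInf_superset_mono image_mono) (auto simp: decseq_def)
  have d_le: "d k \<le> measure M (space M)" for k
  proof -
    obtain f where f: "f \<in> D k" using D(2) by blast
    then have fd: "f \<in> densities M" using D(1) by blast
    have "q f \<le> (\<integral>x. 1 \<partial>M)"
      unfolding q_def using integrable_density_square[OF fd] fd
      by (intro integral_mono) (auto simp: densities_def abs_square_le_1)
    then show ?thesis using q_ge[OF f] by simp
  qed
  have bdd_d: "bdd_above (range d)"
    using d_le by (intro bdd_aboveI) auto
  have d_s: "d k \<le> s" for k
    unfolding s_def using bdd_d by (intro cSup_upper) auto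
  have "\<exists>f N. k \<le> N \<and> f \<in> D N \<and> s - (1/4)^k \<le> d N \<and> q f \<le> s + (1/4)^k" for k
  proof -
    have "s - (1/4)^k < s" by simp
    then obtain j where j: "s - (1/4)^k < d j"
      unfolding s_def using less_cSup_iff[OF _ bdd_d] by auto
    define N where "N = max j k"
    have N: "s - (1/4)^k < d N" "k \<le> N"
      using j inc[of j N] by (auto simp: N_def)
    have "Inf (q ` D N) < s + (1/4)^k"
      using d_s[of N] unfolding d_def[symmetric] by (smt (verit) zero_less_divide_1_iff zero_less_power)
    then obtain f where "f \<in> D N" "q f < s + (1/4)^k"
      using D(2) cInf_lessD[of "q ` D N"] by blast
    then show ?thesis using N by (meson less_imp_le)
  qed
  then obtain f N where fN: "\<And>k. k \<le> N k" "\<And>k. f k \<in> D (N k)"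
      "\<And>k. s - (1/4)^k \<le> d (N k)" "\<And>k. q (f k) \<le> s + (1/4)^k"
    by metis
  have fk: "f k \<in> D k" for k
    using fN(1,2) D(3) unfolding decseq_def by blast
  have fast: "(\<integral>x. (f (Suc k) x - f k x)\<^sup>2 \<partial>M) \<le> 8 * (1/4)^k" for k
  proof -
    define L where "L = min (N k) (N (Suc k))"
    have le: "(1/4::real)^Suc k \<le> (1/4)^k"
      by simp
    have "f k \<in> D L" "f (Suc k) \<in> D L"
      using fN(2)[of k] fN(2)[of "Suc k"] D(3) unfolding decseq_def L_def by (meson min.cobounded1 min.cobounded2 subsetD)+
    then have "d L \<le> q (\<lambda>x. (f (Suc k) x + f k x) / 2)"
      by (intro q_ge mid)
    moreover have "s - (1/4)^k \<le> d L"
      using fN(3)[of k] fN(3)[of "Suc k"] le unfolding L_def min_def by (smt (verit))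
    moreover have "f k \<in> densities M" "f (Suc k) \<in> densities M"
      using fk D(1) by blast+
    ultimately show ?thesis
      using parallelogram_densities[of "f (Suc k)" "f k"] fN(4)[of k] fN(4)[of "Suc k"] le
      unfolding q_def by linarith
  qed
  have "AE x in M. convergent (\<lambda>k. f k x)"
    by (rule AE_convergent_if_fast_L2_Cauchy[OF _ fast]) (use fk D(1) in blast)
  with fk show ?thesis by (rule that)
qed

section \<open>Zonoids are convex bodies\<close>

lemma moment_measuresD:
  assumes "\<mu> \<in> moment_measures"
  shows "sets \<mu> = sets borel" "finite_measure \<mu>" "integrable \<mu> (\<lambda>x. x)"
proof -
  show s: "sets \<mu> = sets borel" and "finite_measure \<mu>"
    using assms by (auto simp: moment_measures_def)
  have "(\<lambda>x. x) \<in> borel_measurable \<mu>"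
    by (simp add: measurable_cong_sets[OF s refl])
  then show "integrable \<mu> (\<lambda>x. x)"
    using assms by (auto simp: moment_measures_def integrable_iff_bounded)
qed

lemma densities_eq:
  "sets \<mu> = sets borel \<Longrightarrow>
    densities \<mu> = {\<phi>. \<phi> \<in> borel_measurable borel \<and> (\<forall>x. \<phi> x \<in> {0..1})}"
  using measurable_cong_sets[of \<mu> borel "borel :: real measure" borel] by (simp add: densities_def)

lemma zonoid_eq_densities:
  assumes "sets \<mu> = sets borel"
  shows "zonoid \<mu> = (\<lambda>\<phi>. \<integral>x. \<phi> x *\<^sub>R x \<partial>\<mu>) ` densities \<mu>"
  unfolding zonoid_def densities_eq[OF assms] by blast

lemma integrable_density_scaleR:
  assumes "\<mu> \<in> moment_measures" "\<phi> \<in> densities \<mu>"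
  shows "integrable \<mu> (\<lambda>x. \<phi> x *\<^sub>R x)"
proof (rule Bochner_Integration.integrable_bound[OF moment_measuresD(3)[OF assms(1)]])
  show "(\<lambda>x. \<phi> x *\<^sub>R x) \<in> borel_measurable \<mu>"
    using assms(2) borel_measurable_integrable[OF moment_measuresD(3)[OF assms(1)]]
    by (intro borel_measurable_scaleR) (simp_all add: densities_def)
  show "AE x in \<mu>. norm (\<phi> x *\<^sub>R x) \<le> norm x"
    using assms(2) by (intro AE_I2) (auto simp: densities_def mult_left_le_one_le)
qed

lemma convex_combination_densities:
  assumes "\<phi> \<in> densities M" "\<psi> \<in> densities M" "0 \<le> a" "0 \<le> b" "a + b = (1::real)"
  shows "(\<lambda>x. a * \<phi> x + b * \<psi> x) \<in> densities M"
proof -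
  have "a * \<phi> x + b * \<psi> x \<le> 1" for x
    using assms by (intro convex_bound_le) (auto simp: densities_def)
  then show ?thesis
    using assms by (auto simp: densities_def)
qed

lemma integral_convex_combination_densities:
  assumes "\<mu> \<in> moment_measures" "\<phi> \<in> densities \<mu>" "\<psi> \<in> densities \<mu>"
  shows "(\<integral>x. (a * \<phi> x + b * \<psi> x) *\<^sub>R x \<partial>\<mu>) =
    a *\<^sub>R (\<integral>x. \<phi> x *\<^sub>R x \<partial>\<mu>) + b *\<^sub>R (\<integral>x. \<psi> x *\<^sub>R x \<partial>\<mu>)"
  using integrable_density_scaleR[OF assms(1)] assms(2,3)
  by (simp add: scaleR_add_left flip: scaleR_scaleR)

lemma convex_zonoid:
  assumes "\<mu> \<in> moment_measures"
  shows "convex (zonoid \<mu>)"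
proof (rule convexI)
  fix y z :: "real ^ 'a" and a b :: real
  assume yz: "y \<in> zonoid \<mu>" "z \<in> zonoid \<mu>" and ab: "0 \<le> a" "0 \<le> b" "a + b = 1"
  then obtain \<phi> \<psi> where "\<phi> \<in> densities \<mu>" "\<psi> \<in> densities \<mu>"
      "y = (\<integral>x. \<phi> x *\<^sub>R x \<partial>\<mu>)" "z = (\<integral>x. \<psi> x *\<^sub>R x \<partial>\<mu>)"
    unfolding zonoid_eq_densities[OF moment_measuresD(1)[OF assms]] by blast
  then show "a *\<^sub>R y + b *\<^sub>R z \<in> zonoid \<mu>"
    unfolding zonoid_eq_densities[OF moment_measuresD(1)[OF assms]]
    using integral_convex_combination_densities[OF assms, of \<phi> \<psi> a b, symmetric]
      convex_combination_densities[OF _ _ ab]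
    by (auto intro!: image_eqI)
qed

lemma bounded_zonoid:
  assumes "\<mu> \<in> moment_measures"
  shows "bounded (zonoid \<mu>)"
proof (rule boundedI)
  fix z assume "z \<in> zonoid \<mu>"
  then obtain \<phi> where \<phi>: "\<phi> \<in> densities \<mu>" "z = (\<integral>x. \<phi> x *\<^sub>R x \<partial>\<mu>)"
    unfolding zonoid_eq_densities[OF moment_measuresD(1)[OF assms]] by blast
  have "norm z \<le> (\<integral>x. norm (\<phi> x *\<^sub>R x) \<partial>\<mu>)"
    unfolding \<phi>(2) by (rule integral_norm_bound)
  also have "\<dots> \<le> (\<integral>x. norm x \<partial>\<mu>)"
  proof (rule integral_mono)
    show "norm (\<phi> x *\<^sub>R x) \<le> norm x" for x
      using \<phi>(1) by (simp add: densities_def mult_left_le_one_le)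
  qed (rule integrable_norm integrable_density_scaleR[OF assms \<phi>(1)] moment_measuresD(3)[OF assms])+
  finally show "norm z \<le> (\<integral>x. norm x \<partial>\<mu>)" .
qed

lemma closed_zonoid:
  assumes \<mu>: "\<mu> \<in> moment_measures"
  shows "closed (zonoid \<mu>)"
proof -
  note eq = zonoid_eq_densities[OF moment_measuresD(1)[OF \<mu>]]
  interpret finite_measure \<mu> by (rule moment_measuresD(2)[OF \<mu>])
  define I where "I \<phi> = (\<integral>x. \<phi> x *\<^sub>R x \<partial>\<mu>)" for \<phi>
  have "z \<in> zonoid \<mu>" if z: "z \<in> closure (zonoid \<mu>)" for z
  proof -
    define D where "D k = {\<phi> \<in> densities \<mu>. I \<phi> \<in> cball z (inverse (Suc k))}" for k
    have "D k \<subseteq> densities \<mu>" for k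
      by (auto simp: D_def)
    moreover have "D k \<noteq> {}" for k
    proof -
      obtain y where "y \<in> zonoid \<mu>" "dist y z < inverse (Suc k)"
        using z closure_approachable[of z] by (metis inverse_positive_iff_positive of_nat_0_less_iff zero_less_Suc)
      then show ?thesis
        unfolding eq D_def I_def by (auto simp: dist_commute intro: less_imp_le)
    qed
    moreover have "decseq D"
    proof (intro decseq_SucI)
      fix k
      have "inverse (real (Suc (Suc k))) \<le> inverse (real (Suc k))"
        by (simp add: field_simps)
      then show "D (Suc k) \<subseteq> D k"
        unfolding D_def using subset_cball by blast
    qed
    moreover have "(\<lambda>x. (\<phi> x + \<psi> x) / 2) \<in> D k" if "\<phi> \<in> D k" "\<psi> \<in> D k" for \<phi> \<psi> k
    proof -
      have *: "(\<lambda>x. (\<phi> x + \<psi> x) / 2) = (\<lambda>x. (1/2) * \<phi> x + (1/2) * \<psi> x)"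
        by (simp add: field_simps)
      have d: "\<phi> \<in> densities \<mu>" "\<psi> \<in> densities \<mu>"
        using that by (auto simp: D_def)
      have "(1/2) *\<^sub>R I \<phi> + (1/2) *\<^sub>R I \<psi> \<in> cball z (inverse (Suc k))"
        using that by (intro convexD[OF convex_cball]) (auto simp: D_def)
      then show ?thesis
        unfolding * D_def I_def
        using integral_convex_combination_densities[OF \<mu> d, of "1/2" "1/2"]
          convex_combination_densities[OF d, of "1/2" "1/2"] by simp
    qed
    ultimately obtain f where f: "\<And>k. f k \<in> D k" and conv: "AE x in \<mu>. convergent (\<lambda>k. f k x)"
      using AE_convergent_selection[of D] by blast
    have fd: "f k \<in> densities \<mu>" for k
      using f by (auto simp: D_def)
    then have meas [measurable]: "f k \<in> borel_measurable \<mu>" for k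
      by (auto simp: densities_def)
    \<comment> \<open>Truncation only matters on the null set where the sequence diverges.\<close>
    define \<phi> where "\<phi> x = max 0 (min 1 (lim (\<lambda>k. f k x)))" for x
    have \<phi>: "\<phi> \<in> densities \<mu>"
      unfolding densities_def \<phi>_def by auto
    have "AE x in \<mu>. (\<lambda>k. f k x *\<^sub>R x) \<longlonglongrightarrow> \<phi> x *\<^sub>R x"
    proof (rule AE_mp[OF conv], intro AE_I2 impI tendsto_scaleR tendsto_const)
      fix x assume "convergent (\<lambda>k. f k x)"
      then have "(\<lambda>k. max 0 (min 1 (f k x))) \<longlonglongrightarrow> \<phi> x"
        unfolding \<phi>_def by (intro tendsto_intros) (simp add: convergent_LIMSEQ_iff)
      moreover have "max 0 (min 1 (f k x)) = f k x" for k
        using fd[of k] by (auto simp: densities_def min_def max_def intro: antisym)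
      ultimately show "(\<lambda>k. f k x) \<longlonglongrightarrow> \<phi> x" by simp
    qed
    then have "(\<lambda>k. I (f k)) \<longlonglongrightarrow> I \<phi>"
      unfolding I_def
      using integrable_density_scaleR[OF \<mu>] \<phi> fd moment_measuresD(3)[OF \<mu>]
      by (intro integral_dominated_convergence[where w = norm])
         (auto simp: densities_def mult_left_le_one_le borel_measurable_integrable)
    moreover have "(\<lambda>k. I (f k)) \<longlonglongrightarrow> z"
    proof (rule metric_tendsto_imp_tendsto[OF LIMSEQ_inverse_real_of_nat])
      show "\<forall>\<^sub>F k in sequentially. dist (I (f k)) z \<le> dist (inverse (real (Suc k))) 0"
        using f by (intro always_eventually) (auto simp: D_def dist_commute)
    qed
    ultimately have "I \<phi> = z"
      by (rule LIMSEQ_unique)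
    then show ?thesis
      unfolding eq I_def using \<phi> by blast
  qed
  then show ?thesis
    using closure_subset_eq by blast
qed

lemma zonoid_in_convex_bodies:
  assumes "\<mu> \<in> moment_measures"
  shows "zonoid \<mu> \<in> convex_bodies"
proof -
  have "(\<lambda>x. 0) \<in> densities \<mu>"
    by (auto simp: densities_def)
  then have "zonoid \<mu> \<noteq> {}"
    unfolding zonoid_eq_densities[OF moment_measuresD(1)[OF assms]] by blast
  then show ?thesis
    using convex_zonoid[OF assms] bounded_zonoid[OF assms] closed_zonoid[OF assms]
    by (simp add: convex_bodies_def compact_eq_bounded_closed)
qed

section \<open>The support function of a zonoid\<close>

definition zonoid_support :: "(real ^ 'n) measure \<Rightarrow> real ^ 'n \<Rightarrow> real" where
  "zonoid_support \<mu> u = (\<integral>x. max 0 (u \<bullet> x) \<partial>\<mu>)"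

lemma inner_zonoid_le_support:
  assumes "\<mu> \<in> moment_measures" "z \<in> zonoid \<mu>"
  shows "u \<bullet> z \<le> zonoid_support \<mu> u"
proof -
  obtain \<phi> where \<phi>: "\<phi> \<in> densities \<mu>" "z = (\<integral>x. \<phi> x *\<^sub>R x \<partial>\<mu>)"
    using assms(2) unfolding zonoid_eq_densities[OF moment_measuresD(1)[OF assms(1)]] by blast
  note int = integrable_density_scaleR[OF assms(1) \<phi>(1)] moment_measuresD(3)[OF assms(1)]
  have "u \<bullet> z = (\<integral>x. u \<bullet> (\<phi> x *\<^sub>R x) \<partial>\<mu>)"
    unfolding \<phi>(2) by (intro integral_inner_right[symmetric] int)
  also have "\<dots> \<le> zonoid_support \<mu> u"
    unfolding zonoid_support_def
  proof (rule integral_mono)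
    fix x
    have "0 \<le> \<phi> x" "\<phi> x \<le> 1" using \<phi>(1) by (auto simp: densities_def)
    then have "\<phi> x * (u \<bullet> x) \<le> max 0 (u \<bullet> x)"
      by (cases "0 \<le> u \<bullet> x") (auto simp: mult_left_le_one_le mult_nonneg_nonpos max_def)
    then show "u \<bullet> (\<phi> x *\<^sub>R x) \<le> max 0 (u \<bullet> x)"
      by simp
  qed (intro integrable_max integrable_inner_right integrable_zero int)+
  finally show ?thesis .
qed

lemma support_attained:
  assumes "\<mu> \<in> moment_measures"
  obtains z where "z \<in> zonoid \<mu>" "u \<bullet> z = zonoid_support \<mu> u"
proof -
  define \<phi> :: "real ^ 'a \<Rightarrow> real" where "\<phi> = indicator {x. 0 < u \<bullet> x}"
  have "{x. 0 < u \<bullet> x} \<in> sets borel"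
    by (intro borel_open open_Collect_less continuous_intros)
  then have \<phi>: "\<phi> \<in> densities \<mu>"
    unfolding densities_eq[OF moment_measuresD(1)[OF assms]] \<phi>_def
    by (auto simp: indicator_def)
  define z where "z = (\<integral>x. \<phi> x *\<^sub>R x \<partial>\<mu>)"
  have "u \<bullet> z = (\<integral>x. u \<bullet> (\<phi> x *\<^sub>R x) \<partial>\<mu>)"
    unfolding z_def by (intro integral_inner_right[symmetric] integrable_density_scaleR[OF assms \<phi>])
  also have "\<dots> = zonoid_support \<mu> u"
    unfolding zonoid_support_def
    by (intro Bochner_Integration.integral_cong) (auto simp: \<phi>_def indicator_def max_def)
  finally have "u \<bullet> z = zonoid_support \<mu> u" .
  moreover have "z \<in> zonoid \<mu>"
    unfolding zonoid_eq_densities[OF moment_measuresD(1)[OF assms]] z_def using \<phi> by blast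
  ultimately show ?thesis by (rule that[rotated])
qed

text \<open>
  The hyperplane through the nearest point \<open>y\<close> of \<open>Z(\<nu>)\<close>, orthogonal to \<open>z - y\<close>, supports \<open>Z(\<nu>)\<close>,
  hence \<open>h\<^sub>\<nu>(u) \<le> \<langle>u, y\<rangle>\<close> for the unit vector \<open>u\<close> in direction \<open>z - y\<close>.
\<close>

lemma zonoid_subset_parallel_body:
  assumes \<mu>: "\<mu> \<in> moment_measures" and \<nu>: "\<nu> \<in> moment_measures" and e: "0 \<le> e"
    and le: "\<And>u. norm u = 1 \<Longrightarrow> zonoid_support \<mu> u \<le> zonoid_support \<nu> u + e"
  shows "zonoid \<mu> \<subseteq> parallel_body (zonoid \<nu>) e"
proof
  fix z assume z: "z \<in> zonoid \<mu>"
  have Z: "compact (zonoid \<nu>)" "convex (zonoid \<nu>)" "zonoid \<nu> \<noteq> {}"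
    using zonoid_in_convex_bodies[OF \<nu>] by (auto simp: convex_bodies_def)
  define y where "y = closest_point (zonoid \<nu>) z"
  have y: "y \<in> zonoid \<nu>"
    unfolding y_def using Z by (intro closest_point_in_set compact_imp_closed)
  have "dist z y \<le> e"
  proof (cases "z = y")
    case False
    define u where "u = (1 / norm (z - y)) *\<^sub>R (z - y)"
    have u: "norm u = 1"
      using False by (simp add: u_def)
    obtain w where w: "w \<in> zonoid \<nu>" "u \<bullet> w = zonoid_support \<nu> u"
      using support_attained[OF \<nu>] .
    have "(z - y) \<bullet> (w - y) \<le> 0"
      unfolding y_def using Z w(1) by (intro closest_point_dot compact_imp_closed)
    then have "u \<bullet> (w - y) \<le> 0"
      by (simp add: u_def divide_le_0_iff)
    moreover have "u \<bullet> (z - y) = dist z y"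
      by (simp add: u_def dist_norm dot_square_norm power2_eq_square)
    moreover have "u \<bullet> z \<le> zonoid_support \<mu> u"
      by (rule inner_zonoid_le_support[OF \<mu> z])
    ultimately show ?thesis
      using le[OF u] w(2) by (simp add: inner_diff_right)
  qed (use e in simp)
  then have "infdist z (zonoid \<nu>) \<le> e"
    using infdist_le[OF y, of z] by linarith
  then show "z \<in> parallel_body (zonoid \<nu>) e"
    using mem_parallel_body_iff[OF Z(1,3) e] by simp
qed

lemma hausdorff_dist_zonoid_le:
  assumes \<mu>: "\<mu> \<in> moment_measures" and \<nu>: "\<nu> \<in> moment_measures" and e: "0 \<le> e"
    and le: "\<And>u. norm u = 1 \<Longrightarrow> \<bar>zonoid_support \<mu> u - zonoid_support \<nu> u\<bar> \<le> e"
  shows "hausdorff_dist (zonoid \<mu>) (zonoid \<nu>) \<le> e"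
proof (rule hausdorff_dist_is_min(2)[OF zonoid_in_convex_bodies[OF \<mu>] zonoid_in_convex_bodies[OF \<nu>]])
  have "zonoid \<mu> \<subseteq> parallel_body (zonoid \<nu>) e"
    by (rule zonoid_subset_parallel_body[OF \<mu> \<nu> e]) (use le in \<open>fastforce simp: abs_le_iff\<close>)
  moreover have "zonoid \<nu> \<subseteq> parallel_body (zonoid \<mu>) e"
    by (rule zonoid_subset_parallel_body[OF \<nu> \<mu> e]) (use le in \<open>fastforce simp: abs_le_iff\<close>)
  ultimately show "e \<in> hausdorff_radii (zonoid \<mu>) (zonoid \<nu>)"
    using e by (simp add: hausdorff_radii_def)
qed

section \<open>Probability measures on a compact set\<close>

text \<open>
  Outside the support every point has an open null neighbourhood; by second countability, countably
  many of them cover the complement of the support.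
\<close>

lemma AE_in_measure_support:
  fixes \<mu> :: "'a :: second_countable_topology measure"
  assumes "sets \<mu> = sets borel"
  shows "AE x in \<mu>. x \<in> measure_support \<mu>"
proof -
  define F where "F = {U. open U \<and> emeasure \<mu> U = 0}"
  obtain F' where F': "F' \<subseteq> F" "countable F'" "\<Union>F' = \<Union>F"
    using Lindelof[of F] unfolding F_def by blast
  have "\<Union>F' \<in> null_sets \<mu>"
    using F'(1,2) assms unfolding F_def
    by (intro null_sets_UN'[of F' id, simplified]) (auto simp: null_sets_def)
  then have "AE x in \<mu>. x \<notin> \<Union>F'"
    by (rule AE_not_in)
  then show ?thesis
    by (rule AE_mp)
       (auto intro!: AE_I2 simp: F'(3) F_def measure_support_def zero_less_iff_neq_zero simp del: Union_iff)
qed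

lemma prob_measures_onD:
  assumes "\<mu> \<in> prob_measures_on K"
  shows "sets \<mu> = sets borel" "prob_space \<mu>" "AE x in \<mu>. x \<in> K"
proof -
  show "sets \<mu> = sets borel" "prob_space \<mu>"
    using assms by (auto simp: prob_measures_on_def)
  then show "AE x in \<mu>. x \<in> K"
    using AE_in_measure_support[of \<mu>] assms by (auto simp: prob_measures_on_def elim!: AE_mp)
qed

lemma prob_measures_on_subset_moment_measures:
  assumes "bounded K"
  shows "prob_measures_on K \<subseteq> moment_measures"
proof
  fix \<mu> assume \<mu>: "\<mu> \<in> prob_measures_on K"
  interpret prob_space \<mu> by (rule prob_measures_onD(2)[OF \<mu>])
  obtain B where "\<And>x. x \<in> K \<Longrightarrow> norm x \<le> B"
    using assms by (auto simp: bounded_iff)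
  then have "AE x in \<mu>. norm x \<le> B"
    using prob_measures_onD(3)[OF \<mu>] by auto
  moreover have "(\<lambda>x. x) \<in> borel_measurable \<mu>"
    by (simp add: measurable_cong_sets[OF prob_measures_onD(1)[OF \<mu>] refl])
  ultimately have "integrable \<mu> (\<lambda>x. x)"
    by (intro integrable_const_bound)
  then show "\<mu> \<in> moment_measures"
    using prob_measures_onD(1)[OF \<mu>] finite_measure_axioms
    by (auto simp: moment_measures_def integrable_iff_bounded)
qed

lemma set_integral_eq_zonoid_support:
  assumes "\<mu> \<in> prob_measures_on K" "closed K"
  shows "(LINT x:K|\<mu>. max 0 (u \<bullet> x)) = zonoid_support \<mu> u"
proof -
  have [measurable]: "K \<in> sets \<mu>" "(\<lambda>x. max 0 (u \<bullet> x)) \<in> borel_measurable \<mu>"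
    using assms(2) prob_measures_onD(1)[OF assms(1)]
    by (auto simp: measurable_cong_sets[OF prob_measures_onD(1)[OF assms(1)] refl])
  show ?thesis
    unfolding zonoid_support_def set_lebesgue_integral_def
    by (rule integral_cong_AE) (use prob_measures_onD(3)[OF assms(1)] in auto)
qed

lemma zonoid_support_Lipschitz:
  assumes \<mu>: "\<mu> \<in> prob_measures_on K" and B: "\<And>x. x \<in> K \<Longrightarrow> norm x \<le> B"
  shows "\<bar>zonoid_support \<mu> u - zonoid_support \<mu> v\<bar> \<le> B * dist u v"
proof -
  interpret prob_space \<mu> by (rule prob_measures_onD(2)[OF \<mu>])
  have "bounded K"
    using B by (auto intro: boundedI)
  then have "integrable \<mu> (\<lambda>x. x)"
    using prob_measures_on_subset_moment_measures \<mu> moment_measuresD(3) by blast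
  then have int: "integrable \<mu> (\<lambda>x. max 0 (w \<bullet> x))" for w
    by (intro integrable_max integrable_inner_right) auto
  have pointwise: "\<bar>max 0 (u \<bullet> x) - max 0 (v \<bullet> x)\<bar> \<le> B * dist u v" if "x \<in> K" for x
  proof -
    have "\<bar>max 0 (u \<bullet> x) - max 0 (v \<bullet> x)\<bar> \<le> \<bar>(u - v) \<bullet> x\<bar>"
      by (auto simp: inner_diff_left)
    also have "\<dots> \<le> dist u v * norm x"
      unfolding dist_norm by (rule Cauchy_Schwarz_ineq2)
    also have "\<dots> \<le> B * dist u v"
      using B[OF that] by (simp add: mult.commute mult_right_mono)
    finally show ?thesis .
  qed
  have "zonoid_support \<mu> u - zonoid_support \<mu> v = (\<integral>x. max 0 (u \<bullet> x) - max 0 (v \<bullet> x) \<partial>\<mu>)"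
    unfolding zonoid_support_def using int by simp
  also have "\<bar>\<dots>\<bar> \<le> (\<integral>x. \<bar>max 0 (u \<bullet> x) - max 0 (v \<bullet> x)\<bar> \<partial>\<mu>)"
    by (rule integral_abs_bound)
  also have "\<dots> \<le> (\<integral>x. B * dist u v \<partial>\<mu>)"
    using int pointwise prob_measures_onD(3)[OF \<mu>]
    by (intro integral_mono_AE) auto
  finally show ?thesis by (simp add: prob_space)
qed

section \<open>Continuity of the zonoid map\<close>

lemma weak_neighbourhood_zonoid_support:
  assumes K: "compact K" and T: "finite T" and e: "0 < e" and \<mu>: "\<mu> \<in> prob_measures_on K"
  obtains V where "openin (weak_topology_on K) V" "\<mu> \<in> V"
    "\<And>\<nu> t. \<nu> \<in> V \<Longrightarrow> t \<in> T \<Longrightarrow> \<bar>zonoid_support \<mu> t - zonoid_support \<nu> t\<bar> < e"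
proof
  define A where "A t = {\<nu> \<in> prob_measures_on K.
      (LINT x:K|\<nu>. max 0 (t \<bullet> x)) \<in> ball (zonoid_support \<mu> t) e}" for t
  define V where "V = prob_measures_on K \<inter> (\<Inter>t\<in>T. A t)"
  have "openin (weak_topology_on K) (A t)" for t
  proof -
    have c: "continuous_on K (\<lambda>x. max 0 (t \<bullet> x))"
      by (intro continuous_intros)
    then have "bounded ((\<lambda>x. max 0 (t \<bullet> x)) ` K)"
      using K by (intro compact_imp_bounded compact_continuous_image)
    with c show ?thesis
      unfolding weak_topology_on_def A_def
      by (intro topology_generated_by_Basis) blast
  qed
  then show "openin (weak_topology_on K) V"
    using openin_Int_Inter[of "A ` T" "weak_topology_on K" "prob_measures_on K"]
      openin_topspace[of "weak_topology_on K"] T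
    by (auto simp: V_def)
  note [simp] = set_integral_eq_zonoid_support[OF _ compact_imp_closed[OF K]]
  show "\<mu> \<in> V"
    using \<mu> e by (auto simp: V_def A_def)
  show "\<bar>zonoid_support \<mu> t - zonoid_support \<nu> t\<bar> < e" if "\<nu> \<in> V" "t \<in> T" for \<nu> t
    using that by (auto simp: V_def A_def dist_real_def)
qed

theorem proposition2p3:
  fixes K :: "(real ^ 'n) set"
  assumes "compact K" "K \<noteq> {}"
  shows "continuous_map (weak_topology_on K) zonoid_topology zonoid"
proof -
  interpret Metric_space "convex_bodies :: (real ^ 'n) set set" hausdorff_dist
    by (rule Metric_space_convex_bodies)
  have moment: "\<mu> \<in> moment_measures" if "\<mu> \<in> prob_measures_on K" for \<mu>
    using prob_measures_on_subset_moment_measures compact_imp_bounded[OF assms(1)] that by blast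
  obtain B where B: "0 < B" "\<And>x. x \<in> K \<Longrightarrow> norm x \<le> B"
    using compact_imp_bounded[OF assms(1)] by (auto simp: bounded_pos)
  have "\<exists>V. openin (weak_topology_on K) V \<and> \<mu> \<in> V \<and> (\<forall>\<nu>\<in>V. zonoid \<nu> \<in> mball (zonoid \<mu>) \<epsilon>)"
    if \<mu>: "\<mu> \<in> prob_measures_on K" and \<epsilon>: "0 < \<epsilon>" for \<mu> \<epsilon>
  proof -
    \<comment> \<open>Passing to the net costs \<open>B \<delta> = \<epsilon>/8\<close> for each of the two measures, comparing them on the net
      costs \<open>\<epsilon>/4\<close>.\<close>
    define \<delta> where "\<delta> = \<epsilon> / (8 * B)"
    have \<delta>: "0 < \<delta>" "B * \<delta> = \<epsilon> / 8"
      using \<epsilon> B(1) by (auto simp: \<delta>_def)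
    obtain T :: "(real ^ 'n) set" where T: "finite T" "sphere 0 1 \<subseteq> (\<Union>t\<in>T. ball t \<delta>)"
      using compact_sphere[of "0 :: real ^ 'n" 1, unfolded compact_eq_totally_bounded] \<delta>(1) by meson
    obtain V where V: "openin (weak_topology_on K) V" "\<mu> \<in> V"
        "\<And>\<nu> t. \<nu> \<in> V \<Longrightarrow> t \<in> T \<Longrightarrow> \<bar>zonoid_support \<mu> t - zonoid_support \<nu> t\<bar> < \<epsilon> / 4"
      using weak_neighbourhood_zonoid_support[OF assms(1) T(1) _ \<mu>, of "\<epsilon> / 4"] \<epsilon> by auto
    have "zonoid \<nu> \<in> mball (zonoid \<mu>) \<epsilon>" if \<nu>V: "\<nu> \<in> V" for \<nu>
    proof -
      have \<nu>: "\<nu> \<in> prob_measures_on K"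
        using openin_subset[OF V(1)] \<nu>V by auto
      have "hausdorff_dist (zonoid \<mu>) (zonoid \<nu>) \<le> \<epsilon> / 2"
      proof (rule hausdorff_dist_zonoid_le[OF moment[OF \<mu>] moment[OF \<nu>]])
        fix u :: "real ^ 'n" assume "norm u = 1"
        then obtain t where t: "t \<in> T" "dist u t < \<delta>"
          using T(2) by (auto simp: subset_iff dist_commute)
        have "B * dist u t \<le> \<epsilon> / 8"
          using t(2) B(1) unfolding \<delta>(2)[symmetric] by simp
        then show "\<bar>zonoid_support \<mu> u - zonoid_support \<nu> u\<bar> \<le> \<epsilon> / 2"
          using zonoid_support_Lipschitz[OF \<mu> B(2), of u t]
            zonoid_support_Lipschitz[OF \<nu> B(2), of u t] V(3)[OF \<nu>V t(1)]
          by linarith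
      qed (use \<epsilon> in simp)
      then show ?thesis
        using zonoid_in_convex_bodies[OF moment[OF \<mu>]] zonoid_in_convex_bodies[OF moment[OF \<nu>]] \<epsilon>
        by simp
    qed
    then show ?thesis using V by blast
  qed
  then have "continuous_map (weak_topology_on K) mtopology zonoid"
    by (simp add: continuous_map_to_metric)
  then show ?thesis
    unfolding zonoid_topology_def zonoids_def
    using moment by (auto simp: continuous_map_in_subtopology)
qed

end
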